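(* Let $X$ and $Y$ be metric spaces, and equip $X\times Y$ with the metric $d((x_1,y_1),(x_2,y_2))=d_X(x_1,x_2)+d_Y(y_1,y_2)$. If $s$ is a decomposition complexity growth function for $X$ and $t$ is a decomposition complexity growth function for $Y$, then the pointwise product $s\cdot t$ is a decomposition complexity growth function for $X\times Y$.
   Context: $\mathbb{R}^+$ denotes the positive reals. For nonempty subsets $A,B$ of a metric space, $d(A,B)=\inf\{d(a,b):a\in A,b\in B\}$. For $R>0$, a family $\mathcal{U}$ of nonempty subsets of a metric space is $R$-disjoint if $d(A,B)>R$ for all $A,B\in\mathcal{U}$ with $A\neq B$. A metric family is a family of metric spaces (subsets of a metric space carry the restricted metric); it is uniformly bounded if the supremum of the diameters of its members is finite. A metric space $X$ $(R,n)$-decomposes over a metric family $\mathcal{V}$, written $X\stackrel{R,n}{\longrightarrow}\mathcal{V}$, if there is a family $\mathcal{U}=\mathcal{U}_1\cup\dots\cup\mathcal{U}_n$ of subsets of $X$ covering $X$ such that each $\mathcal{U}_i$ is $R$-disjoint and $\mathcal{U}\subset\mathcal{V}$. For metric families, $\mathcal{U}\stackrel{R,n}{\longrightarrow}\mathcal{V}$ means that every member of $\mathcal{U}$ $(R,n)$-decomposes over $\mathcal{V}$. A non-decreasing function $s:\mathbb{R}^+\to\mathbb{N}$ is a decomposition complexity growth function for a metric space $X$ if for every sequence $R_1\le R_2\le\cdots$ of positive reals there exist a positive integer $n$ and metric families $\mathcal{V}_1,\dots,\mathcal{V}_n$ with $$X\stackrel{R_1,s(R_1)}{\longrightarrow}\mathcal{V}_1\stackrel{R_2,s(R_2)}{\longrightarrow}\mathcal{V}_2\stackrel{R_3,s(R_3)}{\longrightarrow}\cdots\stackrel{R_n,s(R_n)}{\longrightarrow}\mathcal{V}_n$$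 and $\mathcal{V}_n$ uniformly bounded. *)

theory Defs
  imports "HOL-Analysis.Analysis"
begin

text \<open>
  The type class instance for products and the library's \<open>prod_metric\<close> carry the Euclidean
  combination of the two distances; here the sum is needed.
\<close>

definition sum_metric :: "'a metric \<Rightarrow> 'b metric \<Rightarrow> ('a \<times> 'b) metric" where
  "sum_metric X Y =
     metric (mspace X \<times> mspace Y, \<lambda>(x, y) (x', y'). mdist X x x' + mdist Y y y')"

lemma Metric_space_sum_metric:
  "Metric_space (mspace X \<times> mspace Y) (\<lambda>(x, y) (x', y'). mdist X x x' + mdist Y y y')"
proof
  fix p q r
  assume "p \<in> mspace X \<times> mspace Y" "q \<in> mspace X \<times> mspace Y" "r \<in> mspace X \<times> mspace Y"
  then show "(case p of (x, y) \<Rightarrow> \<lambda>(x', y'). mdist X x x' + mdist Y y y') r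
      \<le> (case p of (x, y) \<Rightarrow> \<lambda>(x', y'). mdist X x x' + mdist Y y y') q
       + (case q of (x, y) \<Rightarrow> \<lambda>(x', y'). mdist X x x' + mdist Y y y') r"
    using mdist_triangle[of "fst p" X "fst q" "fst r"] mdist_triangle[of "snd p" Y "snd q" "snd r"]
    by (auto split: prod.splits)
qed (auto simp: mdist_commute add_nonneg_eq_0_iff split: prod.splits)

lemma mspace_sum_metric [simp]: "mspace (sum_metric X Y) = mspace X \<times> mspace Y"
  unfolding sum_metric_def by (rule Metric_space.mspace_metric[OF Metric_space_sum_metric])

lemma mdist_sum_metric [simp]:
  "mdist (sum_metric X Y) (x, y) (x', y') = mdist X x x' + mdist Y y y'"
  unfolding sum_metric_def by (simp add: Metric_space.mdist_metric[OF Metric_space_sum_metric])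

text \<open>The infimum is only meaningful for nonempty \<open>A\<close> and \<open>B\<close>.\<close>

definition mset_dist :: "'a metric \<Rightarrow> 'a set \<Rightarrow> 'a set \<Rightarrow> real" where
  "mset_dist X A B = (INF (a, b) \<in> A \<times> B. mdist X a b)"

definition R_disjoint :: "'a metric \<Rightarrow> real \<Rightarrow> 'a set set \<Rightarrow> bool" where
  "R_disjoint X R \<U> \<longleftrightarrow>
     (\<forall>A\<in>\<U>. A \<subseteq> mspace X \<and> A \<noteq> {}) \<and>
     (\<forall>A\<in>\<U>. \<forall>B\<in>\<U>. A \<noteq> B \<longrightarrow> mset_dist X A B > R)"

text \<open>
  A metric family is a set of metric spaces, of type \<^typ>\<open>'a metric set\<close>. Suprema are taken in the
  extended reals, so an empty family is uniformly bounded.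
\<close>

definition mdiameter :: "'a metric \<Rightarrow> ereal" where
  "mdiameter X = (SUP (x, y) \<in> mspace X \<times> mspace X. ereal (mdist X x y))"

definition uniformly_bounded_family :: "'a metric set \<Rightarrow> bool" where
  "uniformly_bounded_family \<V> \<longleftrightarrow> (SUP V\<in>\<V>. mdiameter V) < \<infinity>"

text \<open>
  A subset \<open>A\<close> of \<open>X\<close> is regarded as a metric space via \<^term>\<open>submetric X A\<close>. The underlying
  function \<^term>\<open>mdist X\<close> is left unchanged outside \<open>A\<close>, so membership in \<open>\<V>\<close> formally also
  compares distances off the carrier; since the families are existentially quantified
  in the definition of growth functions below, this costs nothing.
\<close>

definition decomposes :: "real \<Rightarrow> nat \<Rightarrow> 'a metric \<Rightarrow> 'a metric set \<Rightarrow> bool" where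
  "decomposes R n X \<V> \<longleftrightarrow>
     (\<exists>\<U> :: nat \<Rightarrow> 'a set set.
        (\<forall>i\<in>{1..n}. R_disjoint X R (\<U> i)) \<and>
        \<Union> (\<Union>i\<in>{1..n}. \<U> i) = mspace X \<and>
        submetric X ` (\<Union>i\<in>{1..n}. \<U> i) \<subseteq> \<V>)"

definition family_decomposes :: "real \<Rightarrow> nat \<Rightarrow> 'a metric set \<Rightarrow> 'a metric set \<Rightarrow> bool" where
  "family_decomposes R n \<U> \<V> \<longleftrightarrow> (\<forall>X\<in>\<U>. decomposes R n X \<V>)"

text \<open>
  Functions on the positive reals are rendered as functions on \<^typ>\<open>real\<close> whose values off
  \<^term>\<open>{0<..} :: real set\<close> are irrelevant. Sequences of radii are indexed from \<open>0\<close>, so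
  \<open>R i\<close> is $R_{i+1}$, and \<open>\<V> 0\<close> is the one-element family consisting of \<open>X\<close>.
\<close>

definition decomposition_complexity_growth :: "'a metric \<Rightarrow> (real \<Rightarrow> nat) \<Rightarrow> bool" where
  "decomposition_complexity_growth X s \<longleftrightarrow>
     mono_on {0<..} s \<and>
     (\<forall>R :: nat \<Rightarrow> real. (\<forall>i. R i > 0) \<and> incseq R \<longrightarrow>
        (\<exists>n\<ge>1. \<exists>\<V> :: nat \<Rightarrow> 'a metric set.
           \<V> 0 = {X} \<and>
           (\<forall>i<n. family_decomposes (R i) (s (R i)) (\<V> i) (\<V> (Suc i))) \<and>
           uniformly_bounded_family (\<V> n)))"

end

theory Submission
  imports Defs
begin

text \<open>
  Products of the pieces of two decompositions, indexed by pairs of colours, decompose the product,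
  so the two chains can be multiplied term by term. They first have to be brought to
  the same length: a chain can be prolonged by trivial decompositions, which need one colour, and
  a growth function of a nonempty space is positive. An empty product is treated separately.
\<close>

lemma mset_dist_le:
  assumes "a \<in> A" "b \<in> B"
  shows "mset_dist X A B \<le> mdist X a b"
proof -
  have "bdd_below ((\<lambda>(a, b). mdist X a b) ` (A \<times> B))"
    by (rule bdd_belowI[of _ 0]) auto
  from cINF_lower[OF this, of "(a, b)"] show ?thesis
    using assms by (simp add: mset_dist_def)
qed

lemma le_mset_dist:
  assumes "A \<noteq> {}" "B \<noteq> {}" "\<And>a b. a \<in> A \<Longrightarrow> b \<in> B \<Longrightarrow> c \<le> mdist X a b"
  shows "c \<le> mset_dist X A B"
  unfolding mset_dist_def by (rule cINF_greatest) (use assms in auto)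

text \<open>Distinct boxes differ in at least one factor, and the sum metric dominates the distance
  in that factor, so the gap there survives in the product. Nonempty pieces are what make a
  pointwise lower bound pass to the infimum.\<close>

lemma R_disjoint_Times:
  assumes "R_disjoint X R \<U>" "R_disjoint Y R \<V>"
  shows "R_disjoint (sum_metric X Y) R ((\<lambda>(A, B). A \<times> B) ` (\<U> \<times> \<V>))"
proof -
  have separated: "mset_dist (sum_metric X Y) (A \<times> B) (A' \<times> B') > R"
    if mem: "A \<in> \<U>" "B \<in> \<V>" "A' \<in> \<U>" "B' \<in> \<V>" and "A \<times> B \<noteq> A' \<times> B'" for A B A' B'
  proof -
    have ne: "A \<times> B \<noteq> {}" "A' \<times> B' \<noteq> {}"
      using assms mem by (auto simp: R_disjoint_def)
    from \<open>A \<times> B \<noteq> A' \<times> B'\<close> consider "A \<noteq> A'" | "B \<noteq> B'" by blast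
    then show ?thesis
    proof cases
      case 1
      then have "R < mset_dist X A A'"
        using assms(1) mem by (auto simp: R_disjoint_def)
      also have "\<dots> \<le> mset_dist (sum_metric X Y) (A \<times> B) (A' \<times> B')"
        by (rule le_mset_dist[OF ne]) (auto intro: order_trans[OF mset_dist_le])
      finally show ?thesis .
    next
      case 2
      then have "R < mset_dist Y B B'"
        using assms(2) mem by (auto simp: R_disjoint_def)
      also have "\<dots> \<le> mset_dist (sum_metric X Y) (A \<times> B) (A' \<times> B')"
        by (rule le_mset_dist[OF ne]) (auto intro: order_trans[OF mset_dist_le])
      finally show ?thesis .
    qed
  qed
  have "A \<times> B \<subseteq> mspace X \<times> mspace Y" "A \<times> B \<noteq> {}" if "A \<in> \<U>" "B \<in> \<V>" for A B
  proof -
    have "A \<subseteq> mspace X" "A \<noteq> {}" "B \<subseteq> mspace Y" "B \<noteq> {}"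
      using assms that by (simp_all add: R_disjoint_def)
    then show "A \<times> B \<subseteq> mspace X \<times> mspace Y" "A \<times> B \<noteq> {}" by auto
  qed
  with separated show ?thesis
    unfolding R_disjoint_def mspace_sum_metric by (intro conjI ballI impI; elim imageE SigmaE; simp)
qed

lemma metric_eqI:
  assumes "mspace m = mspace m'" "mdist m = mdist m'"
  shows "m = m'"
  using assms by (simp add: mspace_def mdist_def prod_eq_iff flip: dest_metric_inject)

text \<open>This is an equality of metrics, not just an isometry: \<open>submetric\<close> leaves
  \<open>mdist\<close> unchanged off the carrier, so both sides carry the same distance function
  everywhere. Membership of a box in the product family can therefore be checked literally.\<close>

lemma submetric_sum_metric:
  "submetric (sum_metric X Y) (A \<times> B) = sum_metric (submetric X A) (submetric Y B)"
proof (rule metric_eqI)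
  show "mspace (submetric (sum_metric X Y) (A \<times> B)) = mspace (sum_metric (submetric X A) (submetric Y B))"
    by auto
qed (auto simp: fun_eq_iff)

lemma decomposes_sum_metric:
  assumes "decomposes R m X \<U>" "decomposes R n Y \<V>"
  shows "decomposes R (m * n) (sum_metric X Y) ((\<lambda>(A, B). sum_metric A B) ` (\<U> \<times> \<V>))"
proof -
  obtain U where U: "\<And>i. i \<in> {1..m} \<Longrightarrow> R_disjoint X R (U i)"
    "\<Union> (\<Union>i\<in>{1..m}. U i) = mspace X" "submetric X ` (\<Union>i\<in>{1..m}. U i) \<subseteq> \<U>"
    using assms(1) unfolding decomposes_def by metis
  obtain V where V: "\<And>i. i \<in> {1..n} \<Longrightarrow> R_disjoint Y R (V i)"
    "\<Union> (\<Union>i\<in>{1..n}. V i) = mspace Y" "submetric Y ` (\<Union>i\<in>{1..n}. V i) \<subseteq> \<V>"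
    using assms(2) unfolding decomposes_def by metis
  \<comment> \<open>Colours of the product are pairs \<open>(i, j)\<close>, while
    \<open>decomposes\<close> wants them numbered from 1 to \<open>m * n\<close>; any bijection does
    the renumbering.\<close>
  obtain h where h: "bij_betw h {1..m * n} ({1..m} \<times> {1..n})"
    using finite_same_card_bij[of "{1..m * n}" "{1..m} \<times> {1..n}"]
    by (auto simp: card_cartesian_product)
  define P where "P = (\<lambda>(i, j). (\<lambda>(A, B). A \<times> B) ` (U i \<times> V j))"
  \<comment> \<open>Covering and membership of pieces concern only the union over all colours, so
    \<open>h\<close> drops out of both.\<close>
  have P: "(\<Union>k\<in>{1..m * n}. P (h k)) = (\<Union>p\<in>{1..m} \<times> {1..n}. P p)"
    unfolding bij_betw_imp_surj_on[OF h, symmetric] by simp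
  have disjoint: "R_disjoint (sum_metric X Y) R (P (h k))" if "k \<in> {1..m * n}" for k
  proof -
    have "h k \<in> {1..m} \<times> {1..n}"
      using bij_betwE[OF h] that by blast
    then show ?thesis
      by (cases "h k") (simp add: P_def R_disjoint_Times U(1) V(1))
  qed
  have cover: "\<Union> (\<Union>k\<in>{1..m * n}. P (h k)) = mspace (sum_metric X Y)"
    unfolding P unfolding mspace_sum_metric U(2)[symmetric] V(2)[symmetric] P_def by auto
  have pieces: "submetric (sum_metric X Y) ` (\<Union>k\<in>{1..m * n}. P (h k))
      \<subseteq> (\<lambda>(A, B). sum_metric A B) ` (\<U> \<times> \<V>)"
  proof -
    have "submetric (sum_metric X Y) (A \<times> B) \<in> (\<lambda>(A, B). sum_metric A B) ` (\<U> \<times> \<V>)"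
      if "i \<in> {1..m}" "j \<in> {1..n}" "A \<in> U i" "B \<in> V j" for i j A B
      unfolding submetric_sum_metric using U(3) V(3) that by blast
    then show ?thesis unfolding P by (auto simp: P_def)
  qed
  show ?thesis
    unfolding decomposes_def
    by (rule exI[of _ "\<lambda>k. P (h k)"]) (use disjoint cover pieces in blast)
qed

lemma family_decomposes_sum_metric:
  assumes "family_decomposes R m \<U> \<U>'" "family_decomposes R n \<V> \<V>'"
  shows "family_decomposes R (m * n) ((\<lambda>(A, B). sum_metric A B) ` (\<U> \<times> \<V>))
    ((\<lambda>(A, B). sum_metric A B) ` (\<U>' \<times> \<V>'))"
  using assms by (auto simp: family_decomposes_def intro: decomposes_sum_metric)

text \<open>Replaces the extended-real supremum by one real bound, so that bounds for two families
  can simply be added.\<close>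

lemma uniformly_bounded_family_iff:
  "uniformly_bounded_family \<V> \<longleftrightarrow>
     (\<exists>C. \<forall>V\<in>\<V>. \<forall>x\<in>mspace V. \<forall>y\<in>mspace V. mdist V x y \<le> C)"
proof
  assume "uniformly_bounded_family \<V>"
  \<comment> \<open>Density gives a real strictly between the supremum and infinity, even when the
    supremum is minus infinity, as for an empty family.\<close>
  then obtain C :: real where C: "(SUP V\<in>\<V>. mdiameter V) < ereal C"
    unfolding uniformly_bounded_family_def by (blast dest: ereal_dense2)
  have "mdiameter V \<le> ereal C" if "V \<in> \<V>" for V
    using le_less_trans[OF SUP_upper[OF that, of mdiameter] C] by (rule less_imp_le)
  then show "\<exists>C. \<forall>V\<in>\<V>. \<forall>x\<in>mspace V. \<forall>y\<in>mspace V. mdist V x y \<le> C"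
    by (auto simp: mdiameter_def SUP_le_iff)
next
  assume "\<exists>C. \<forall>V\<in>\<V>. \<forall>x\<in>mspace V. \<forall>y\<in>mspace V. mdist V x y \<le> C"
  then obtain C where "\<forall>V\<in>\<V>. mdiameter V \<le> ereal C"
    by (auto simp: mdiameter_def SUP_le_iff)
  then have "(SUP V\<in>\<V>. mdiameter V) \<le> ereal C"
    by (simp add: SUP_le_iff)
  then show "uniformly_bounded_family \<V>"
    unfolding uniformly_bounded_family_def by (rule le_less_trans) simp
qed

lemma uniformly_bounded_family_sum_metric:
  assumes "uniformly_bounded_family \<U>" "uniformly_bounded_family \<V>"
  shows "uniformly_bounded_family ((\<lambda>(A, B). sum_metric A B) ` (\<U> \<times> \<V>))"
proof -
  obtain C D where "\<forall>V\<in>\<U>. \<forall>x\<in>mspace V. \<forall>y\<in>mspace V. mdist V x y \<le> C"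
    "\<forall>V\<in>\<V>. \<forall>x\<in>mspace V. \<forall>y\<in>mspace V. mdist V x y \<le> D"
    using assms unfolding uniformly_bounded_family_iff by blast
  then show ?thesis
    unfolding uniformly_bounded_family_iff
    by (intro exI[of _ "C + D"]) (auto intro!: add_mono)
qed

lemma decomposes_empty:
  assumes "mspace X = {}"
  shows "decomposes R n X \<V>"
  unfolding decomposes_def by (rule exI[of _ "\<lambda>_. {}"]) (simp add: assms R_disjoint_def)

text \<open>The whole space serves as the only piece, repeated in every colour; a one-piece family
  is vacuously \<open>R\<close>-disjoint. An empty carrier is no admissible piece, hence the case
  split.\<close>

lemma decomposes_refl:
  assumes "n > 0" "X \<in> \<V>"
  shows "decomposes R n X \<V>"
proof (cases "mspace X = {}")
  case False
  have "(\<Union>i\<in>{1..n}. {mspace X}) = {mspace X}"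
    using assms(1) by auto
  with False assms(2) show ?thesis
    unfolding decomposes_def
    by (intro exI[of _ "\<lambda>_. {mspace X}"]) (simp add: R_disjoint_def)
qed (rule decomposes_empty)

text \<open>Zero colours cover only the empty set, so the first step of a chain would already
  fail.\<close>

lemma decomposition_complexity_growth_pos:
  assumes "decomposition_complexity_growth X s" "mspace X \<noteq> {}" "R > 0"
  shows "s R > 0"
proof (rule ccontr)
  assume "\<not> s R > 0"
  \<comment> \<open>The constant sequence \<open>R\<close> puts the first step at the given radius,
    and \<open>n \<ge> 1\<close> ensures that this step exists.\<close>
  obtain n \<V> where "n \<ge> 1" "\<V> 0 = {X}" "\<forall>i<n. family_decomposes R (s R) (\<V> i) (\<V> (Suc i))"
    using assms(1,3) unfolding decomposition_complexity_growth_def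
    by (auto dest!: spec[of _ "\<lambda>_. R"])
  then have "family_decomposes R (s R) {X} (\<V> 1)"
    by (metis One_nat_def less_eq_Suc_le)
  with \<open>\<not> s R > 0\<close> assms(2) show False
    by (simp add: family_decomposes_def decomposes_def)
qed

text \<open>Every sufficiently large length is attained for the same radii, so a common length can
  be chosen for two spaces.\<close>

lemma decomposition_complexity_growth_long_chains:
  assumes "decomposition_complexity_growth X s" "mspace X \<noteq> {}" "\<And>i. R i > 0" "incseq R"
  obtains n where "\<And>N. N \<ge> n \<Longrightarrow> \<exists>\<V>. \<V> 0 = {X} \<and>
    (\<forall>i<N. family_decomposes (R i) (s (R i)) (\<V> i) (\<V> (Suc i))) \<and> uniformly_bounded_family (\<V> N)"
proof -
  obtain n \<V> where \<V>: "\<V> 0 = {X}"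
    "\<And>i. i < n \<Longrightarrow> family_decomposes (R i) (s (R i)) (\<V> i) (\<V> (Suc i))"
    "uniformly_bounded_family (\<V> n)"
    using assms unfolding decomposition_complexity_growth_def by metis
  show thesis
  proof
    fix N assume "N \<ge> n"
    \<comment> \<open>The chain is frozen at its last family: from \<open>n\<close> on both indices
      equal \<open>n\<close>, and each member decomposes over the family containing it because
      \<open>s (R i)\<close> is positive.\<close>
    have "family_decomposes (R i) (s (R i)) (\<V> (min i n)) (\<V> (min (Suc i) n))" for i
    proof (cases "i < n")
      case False
      then show ?thesis
        using decomposition_complexity_growth_pos[OF assms(1,2), of "R i"] assms(3)
        by (auto simp: family_decomposes_def intro: decomposes_refl)
    qed (use \<V>(2) in \<open>simp add: min_def\<close>)
    with \<V> \<open>N \<ge> n\<close> show "\<exists>\<V>. \<V> 0 = {X} \<and>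
      (\<forall>i<N. family_decomposes (R i) (s (R i)) (\<V> i) (\<V> (Suc i))) \<and> uniformly_bounded_family (\<V> N)"
      by (intro exI[of _ "\<lambda>i. \<V> (min i n)"]) (simp add: min_absorb2)
  qed
qed

theorem theorem4p1:
  fixes X :: "'a metric" and Y :: "'b metric"
    and s t :: "real \<Rightarrow> nat"
  assumes "decomposition_complexity_growth X s"
    and "decomposition_complexity_growth Y t"
  shows "decomposition_complexity_growth (sum_metric X Y) (\<lambda>R. s R * t R)"
  unfolding decomposition_complexity_growth_def
proof (intro conjI allI impI)
  show "mono_on {0<..} (\<lambda>R. s R * t R)"
    using assms by (auto simp: decomposition_complexity_growth_def monotone_on_def intro!: mult_le_mono)
next
  fix R :: "nat \<Rightarrow> real"
  assume "(\<forall>i. R i > 0) \<and> incseq R"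
  then have R: "\<And>i. R i > 0" "incseq R" by auto
  show "\<exists>n\<ge>1. \<exists>\<V>. \<V> 0 = {sum_metric X Y} \<and>
    (\<forall>i<n. family_decomposes (R i) (s (R i) * t (R i)) (\<V> i) (\<V> (Suc i))) \<and>
    uniformly_bounded_family (\<V> n)"
  proof (cases "mspace X = {} \<or> mspace Y = {}")
    case True
    then show ?thesis
      \<comment> \<open>An empty product decomposes over the empty family with any number of
        colours, even zero, and the empty family is uniformly bounded.\<close>
      by (intro exI[of _ 1] conjI exI[of _ "\<lambda>i. if i = 0 then {sum_metric X Y} else {}"])
        (auto simp: family_decomposes_def uniformly_bounded_family_iff intro!: decomposes_empty)
  next
    case False
    then have ne: "mspace X \<noteq> {}" "mspace Y \<noteq> {}" by auto
    obtain m where m: "\<And>N. N \<ge> m \<Longrightarrow> \<exists>\<V>. \<V> 0 = {X} \<and>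
      (\<forall>i<N. family_decomposes (R i) (s (R i)) (\<V> i) (\<V> (Suc i))) \<and> uniformly_bounded_family (\<V> N)"
      using decomposition_complexity_growth_long_chains[OF assms(1) ne(1) R] by blast
    obtain n where n: "\<And>N. N \<ge> n \<Longrightarrow> \<exists>\<V>. \<V> 0 = {Y} \<and>
      (\<forall>i<N. family_decomposes (R i) (t (R i)) (\<V> i) (\<V> (Suc i))) \<and> uniformly_bounded_family (\<V> N)"
      using decomposition_complexity_growth_long_chains[OF assms(2) ne(2) R] by blast
    \<comment> \<open>The 1 secures the positive length demanded by the definition, since
      \<open>m\<close> and \<open>n\<close> are not known to be positive.\<close>
    define N where "N = max 1 (max m n)"
    have N: "N \<ge> 1" "N \<ge> m" "N \<ge> n" by (simp_all add: N_def)
    obtain \<U> where \<U>: "\<U> 0 = {X}" "uniformly_bounded_family (\<U> N)"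
      "\<forall>i<N. family_decomposes (R i) (s (R i)) (\<U> i) (\<U> (Suc i))"
      using m[OF N(2)] by blast
    obtain \<V> where \<V>: "\<V> 0 = {Y}" "uniformly_bounded_family (\<V> N)"
      "\<forall>i<N. family_decomposes (R i) (t (R i)) (\<V> i) (\<V> (Suc i))"
      using n[OF N(3)] by blast
    show ?thesis
    proof (intro exI[of _ N] conjI exI[of _ "\<lambda>i. (\<lambda>(A, B). sum_metric A B) ` (\<U> i \<times> \<V> i)"])
      show "N \<ge> 1" by (rule N(1))
    qed (use \<U> \<V> in \<open>auto intro: family_decomposes_sum_metric uniformly_bounded_family_sum_metric\<close>)
  qed
qed

end
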